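(* Let $X$ be a real normed space and let $K\subset X$ be a convex body. Then for all $\mathbf{x}\in K$ we have $$\gamma^2(K,\mathbf{x})=4\,\omega(K,\mathbf{x})\big(1-\omega(K,\mathbf{x})\big).$$
   Context: $X$ is a real normed space, $X\neq\{0\}$, with unit sphere $S$. A convex body is a bounded, closed, convex set with nonempty interior. For $\mathbf{x}\in X$ let $\mathcal{L}=\mathcal{L}(K,\mathbf{x})$ be the set of straight lines $l=\{\mathbf{x}+t\mathbf{v}:t\in\mathbb{R}\}$, $\mathbf{v}\in S$, that meet $K$ in more than one point; for $l\in\mathcal{L}$ write $K\cap l=[\mathbf{a},\mathbf{b}]$, $\mathbf{a}\neq\mathbf{b}$, with endpoints labelled so that $\|\mathbf{x}-\mathbf{b}\|\le\|\mathbf{x}-\mathbf{a}\|$. For $\mathbf{x}\in K$ define $$\omega(K,\mathbf{x})=\sup_{l\in\mathcal{L}}\frac{\|\mathbf{a}-\mathbf{x}\|}{\|\mathbf{a}-\mathbf{b}\|},\qquad \gamma^2(K,\mathbf{x})=\inf_{l\in\mathcal{L}}\frac{\|\mathbf{b}-\mathbf{x}\|\,\|\mathbf{a}-\mathbf{x}\|}{\left\|\frac12(\mathbf{b}-\mathbf{a})\right\|^2}.$$ *)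

theory Defs
  imports "HOL-Analysis.Analysis"
begin

definition convex_body :: "'a::real_normed_vector set \<Rightarrow> bool" where
  "convex_body K \<longleftrightarrow> bounded K \<and> closed K \<and> convex K \<and> interior K \<noteq> {}"

definition chord_lines :: "'a::real_normed_vector set \<Rightarrow> 'a \<Rightarrow> 'a set set" where
  "chord_lines K x =
     {l. (\<exists>v \<in> sphere 0 1. l = {x + t *\<^sub>R v | t. t \<in> (UNIV :: real set)}) \<and>
         (\<exists>p \<in> K \<inter> l. \<exists>q \<in> K \<inter> l. p \<noteq> q)}"

text \<open>The labelling of the endpoints is unique, except when \<open>x\<close> is equidistant from them.
  If \<open>x \<in> K\<close> this means that \<open>x\<close> is the midpoint of the chord, and then the quotients
  below do not depend on the labelling.\<close>

definition chord_ends :: "'a::real_normed_vector set \<Rightarrow> 'a \<Rightarrow> 'a set \<Rightarrow> 'a \<Rightarrow> 'a \<Rightarrow> bool" where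
  "chord_ends K x l a b \<longleftrightarrow>
     K \<inter> l = closed_segment a b \<and> a \<noteq> b \<and> norm (x - b) \<le> norm (x - a)"

text \<open>For a convex body \<open>K\<close> and \<open>x \<in> K\<close> with the space nonzero, the two sets below are
  nonempty and lie in \<open>{0..1}\<close>, so the real supremum and infimum are the usual ones.\<close>

definition omega :: "'a::real_normed_vector set \<Rightarrow> 'a \<Rightarrow> real" where
  "omega K x =
     Sup {norm (a - x) / norm (a - b) | a b. \<exists>l \<in> chord_lines K x. chord_ends K x l a b}"

text \<open>The quantity \<open>\<gamma>\<^sup>2(K, x)\<close>, defined directly as an infimum.\<close>

definition gamma_sq :: "'a::real_normed_vector set \<Rightarrow> 'a \<Rightarrow> real" where
  "gamma_sq K x =
     Inf {norm (b - x) * norm (a - x) / (norm ((1/2) *\<^sub>R (b - a)))\<^sup>2 | a b.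
            \<exists>l \<in> chord_lines K x. chord_ends K x l a b}"

end

theory Submission
  imports Defs
begin

text \<open>
  Fix \<open>x \<in> K\<close>.  On a chord with endpoints \<open>a\<close>, \<open>b\<close> through \<open>x\<close>, the point \<open>x\<close> lies between
  \<open>a\<close> and \<open>b\<close>, so the quotient \<open>w = \<parallel>a - x\<parallel> / \<parallel>a - b\<parallel>\<close> has complement
  \<open>1 - w = \<parallel>b - x\<parallel> / \<parallel>a - b\<parallel>\<close>.  Hence the quotient minimised in \<open>\<gamma>\<^sup>2\<close> is the value at \<open>w\<close> of
  the parabola \<open>4w(1 - w)\<close> (lemma \<open>product_ratio_eq_parabola\<close>), and the choice of labels puts
  \<open>w\<close> into \<open>[1/2, 1]\<close>.  There the parabola is continuous and decreasing, so it turns the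
  supremum of the values \<open>w\<close> into the infimum of its own values (lemma \<open>Inf_parabola_image\<close>).

  Since both extrema are taken in the reals, it must also be known that there are chords at
  all.  A body with nonempty interior in a nonzero space has a point other than \<open>x\<close>, and the
  line through the two meets \<open>K\<close> in a segment, although closed bounded sets need not be
  compact in \<open>X\<close>: the parameters of the line that belong to \<open>K\<close> form a compact interval of
  reals (lemma \<open>chord_ends_exist\<close>).
\<close>

text \<open>Beyond its vertex at \<open>1/2\<close> the parabola is decreasing.  Flattening it to the left of the
  vertex makes it decreasing and continuous on the whole line without changing any value in
  question, so that the general fact on continuous antitone maps applies.\<close>

lemma Inf_parabola_image:
  fixes W :: "real set"
  assumes "W \<noteq> {}" and "bdd_above W" and ge: "\<And>w. w \<in> W \<Longrightarrow> 1/2 \<le> w"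
  shows "(INF w\<in>W. 4 * w * (1 - w)) = 4 * Sup W * (1 - Sup W)"
proof -
  define g :: "real \<Rightarrow> real" where "g w = 4 * max (1/2) w * (1 - max (1/2) w)" for w
  have "antimono g"
  proof (rule antimonoI)
    fix u v :: real
    assume "u \<le> v"
    define p q where "p = max (1/2) u" and "q = max (1/2) v"
    have "p \<le> q" "1/2 \<le> p"
      using \<open>u \<le> v\<close> by (auto simp: p_def q_def)
    then have "0 \<le> (q - p) * (p + q - 1)"
      by (intro mult_nonneg_nonneg) auto
    then show "g v \<le> g u"
      unfolding g_def p_def[symmetric] q_def[symmetric] by (simp add: algebra_simps)
  qed
  moreover have "continuous (at_left (Sup W)) g"
    unfolding g_def by (intro continuous_intros)
  ultimately have "g (Sup W) = (INF w\<in>W. g w)"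
    using assms by (intro continuous_at_Sup_antimono) auto
  moreover have "g w = 4 * w * (1 - w)" if "1/2 \<le> w" for w
    using that by (simp add: g_def max_def)
  moreover have "1/2 \<le> Sup W"
    using assms by (meson cSup_upper2 ex_in_conv)
  ultimately show ?thesis
    using ge by simp
qed

lemma norm_split_closed_segment:
  fixes a b x :: "'a::real_normed_vector"
  assumes "x \<in> closed_segment a b"
  shows "norm (a - b) = norm (a - x) + norm (b - x)"
proof -
  obtain u where u: "0 \<le> u" "u \<le> 1" and x: "x = (1 - u) *\<^sub>R a + u *\<^sub>R b"
    using assms by (auto simp: in_segment)
  have "a - x = u *\<^sub>R (a - b)" "b - x = (1 - u) *\<^sub>R (b - a)"
    by (simp_all add: x algebra_simps)
  then have "norm (a - x) = u * norm (a - b)" "norm (b - x) = (1 - u) * norm (a - b)"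
    using u by (simp_all add: norm_minus_commute)
  then show ?thesis
    by (simp add: algebra_simps)
qed

lemma product_ratio_eq_parabola:
  fixes a b x :: "'a::real_normed_vector"
  assumes "x \<in> closed_segment a b" and "a \<noteq> b"
  defines "w \<equiv> norm (a - x) / norm (a - b)"
  shows "norm (b - x) * norm (a - x) / (norm ((1/2) *\<^sub>R (b - a)))\<^sup>2 = 4 * w * (1 - w)"
proof -
  have "norm (a - b) = norm (a - x) + norm (b - x)"
    using norm_split_closed_segment assms(1) by blast
  moreover have "norm (a - b) \<noteq> 0"
    using \<open>a \<noteq> b\<close> by simp
  ultimately have "1 - w = norm (b - x) / norm (a - b)"
    unfolding w_def by (metis add_diff_cancel_left' diff_divide_distrib divide_self)
  then show ?thesis
    by (simp add: w_def power2_eq_square norm_minus_commute)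
qed

lemma far_ratio_bounds:
  fixes a b x :: "'a::real_normed_vector"
  assumes "x \<in> closed_segment a b" and "a \<noteq> b" and "norm (x - b) \<le> norm (x - a)"
  shows "1/2 \<le> norm (a - x) / norm (a - b)" and "norm (a - x) / norm (a - b) \<le> 1"
proof -
  have "norm (a - b) = norm (a - x) + norm (b - x)"
    using norm_split_closed_segment assms(1) by blast
  then have "norm (a - b) \<le> 2 * norm (a - x)" "norm (a - x) \<le> norm (a - b)"
    using assms(3) by (simp_all add: norm_minus_commute)
  moreover have "0 < norm (a - b)"
    using \<open>a \<noteq> b\<close> by simp
  ultimately show "1/2 \<le> norm (a - x) / norm (a - b)" "norm (a - x) / norm (a - b) \<le> 1"
    by (simp_all add: pos_le_divide_eq)
qed

lemma chord_line_contains_base: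
  assumes "l \<in> chord_lines K x"
  shows "x \<in> l"
  using assms unfolding chord_lines_def by (force intro: exI[of _ "0::real"])

lemma base_between_chord_ends:
  assumes "x \<in> K" and "l \<in> chord_lines K x" and "chord_ends K x l a b"
  shows "x \<in> closed_segment a b"
  using assms chord_line_contains_base unfolding chord_ends_def by blast

text \<open>In infinite dimensions \<open>K\<close> is not compact, so compactness is sought one-dimensionally:
  the parametrisation of the line by its unit direction is an isometry, so it pulls \<open>K\<close> back
  to a closed, bounded and convex set of reals.\<close>

lemma chord_ends_exist:
  fixes K :: "'a::real_normed_vector set"
  assumes "bounded K" and "closed K" and "convex K" and "l \<in> chord_lines K x"
  shows "\<exists>a b. chord_ends K x l a b"
proof -
  obtain v p q where v: "norm v = 1" and l: "l = range (\<lambda>t::real. x + t *\<^sub>R v)"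
    and pq: "p \<in> K \<inter> l" "q \<in> K \<inter> l" "p \<noteq> q"
    using assms(4) unfolding chord_lines_def mem_Collect_eq
    by (elim conjE bexE) (auto simp: full_SetCompr_eq intro: that)
  define T where "T = {t. x + t *\<^sub>R v \<in> K}"
  have Kl: "K \<inter> l = (\<lambda>t. x + t *\<^sub>R v) ` T"
    by (auto simp: T_def l)
  have "closed ((\<lambda>t. x + t *\<^sub>R v) -` K)"
    by (intro closed_vimage \<open>closed K\<close> continuous_intros)
  then have "closed T"
    by (simp add: T_def vimage_def)
  moreover have "bounded T"
  proof -
    obtain B where B: "\<And>y. y \<in> K \<Longrightarrow> norm y \<le> B"
      using \<open>bounded K\<close> bounded_iff by metis
    have "norm t \<le> B + norm x" if "t \<in> T" for t
    proof -
      have "norm t = norm ((x + t *\<^sub>R v) - x)"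
        using v by simp
      also have "\<dots> \<le> norm (x + t *\<^sub>R v) + norm x"
        by (rule norm_triangle_ineq4)
      finally show ?thesis
        using B[of "x + t *\<^sub>R v"] that by (simp add: T_def)
    qed
    then show ?thesis
      using bounded_iff by blast
  qed
  ultimately have "compact T"
    using compact_eq_bounded_closed by blast
  moreover have "convex T"
  proof (rule convexI)
    fix s t u w :: real
    assume st: "s \<in> T" "t \<in> T" and uw: "0 \<le> u" "0 \<le> w" "u + w = 1"
    have "x + (u *\<^sub>R s + w *\<^sub>R t) *\<^sub>R v = (u + w) *\<^sub>R x + (u *\<^sub>R s + w *\<^sub>R t) *\<^sub>R v"
      using uw by simp
    also have "\<dots> = u *\<^sub>R (x + s *\<^sub>R v) + w *\<^sub>R (x + t *\<^sub>R v)"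
      by (simp add: algebra_simps)
    also have "\<dots> \<in> K"
      using st uw \<open>convex K\<close> by (intro convexD) (auto simp: T_def)
    finally show "u *\<^sub>R s + w *\<^sub>R t \<in> T"
      by (simp add: T_def)
  qed
  ultimately obtain c d where cd: "T = {c..d}"
    using connected_compact_interval_1 convex_connected by blast
  have "c \<le> d"
    using pq Kl cd by fastforce
  have "K \<inter> l = (\<lambda>y. x + y) ` (\<lambda>t. t *\<^sub>R v) ` closed_segment c d"
    using \<open>c \<le> d\<close> by (simp add: Kl cd closed_segment_eq_real_ivl image_image)
  also have "\<dots> = closed_segment (x + c *\<^sub>R v) (x + d *\<^sub>R v)"
    using closed_segment_linear_image
      [OF bounded_linear.linear[OF bounded_linear_scaleR_left], of c v d]
    by (simp add: closed_segment_translation)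
  finally have seg: "K \<inter> l = closed_segment (x + c *\<^sub>R v) (x + d *\<^sub>R v)" .
  have ne: "x + c *\<^sub>R v \<noteq> x + d *\<^sub>R v"
    using pq seg by auto
  show ?thesis
  proof (cases "norm (x - (x + d *\<^sub>R v)) \<le> norm (x - (x + c *\<^sub>R v))")
    case True
    then show ?thesis
      using seg ne unfolding chord_ends_def by blast
  next
    case False
    then have "chord_ends K x l (x + d *\<^sub>R v) (x + c *\<^sub>R v)"
      using seg ne closed_segment_commute[of "x + c *\<^sub>R v" "x + d *\<^sub>R v"]
      unfolding chord_ends_def by auto
    then show ?thesis
      by blast
  qed
qed

lemma interior_nonempty_imp_other_point:
  fixes K :: "'a::real_normed_vector set"
  assumes "(UNIV :: 'a set) \<noteq> {0}" and "interior K \<noteq> {}"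
  shows "\<exists>p\<in>K. p \<noteq> x"
proof -
  obtain u :: 'a where "u \<noteq> 0"
    using assms(1) by auto
  obtain y e where "e > 0" and ball: "ball y e \<subseteq> K"
    using assms(2) mem_interior by blast
  define z where "z = y + (e / 2 / norm u) *\<^sub>R u"
  have "y \<in> K" "z \<in> K"
    using \<open>e > 0\<close> \<open>u \<noteq> 0\<close> by (auto intro!: subsetD[OF ball] simp: z_def dist_norm)
  moreover have "z \<noteq> y"
    using \<open>e > 0\<close> \<open>u \<noteq> 0\<close> by (simp add: z_def)
  ultimately show ?thesis
    by metis
qed

lemma chord_lines_nonempty:
  fixes K :: "'a::real_normed_vector set"
  assumes "x \<in> K" and "p \<in> K" and "p \<noteq> x"
  shows "chord_lines K x \<noteq> {}"
proof -
  define v where "v = (p - x) /\<^sub>R norm (p - x)"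
  define l where "l = {x + t *\<^sub>R v | t. t \<in> (UNIV :: real set)}"
  have "v \<in> sphere 0 1"
    using \<open>p \<noteq> x\<close> by (simp add: v_def)
  moreover have "p = x + norm (p - x) *\<^sub>R v" "x = x + 0 *\<^sub>R v"
    using \<open>p \<noteq> x\<close> by (simp_all add: v_def)
  then have "p \<in> K \<inter> l" "x \<in> K \<inter> l"
    using assms unfolding l_def by blast+
  ultimately have "l \<in> chord_lines K x"
    using \<open>p \<noteq> x\<close> unfolding chord_lines_def l_def by blast
  then show ?thesis
    by blast
qed

theorem proposition4p10:
  fixes K :: "'a::real_normed_vector set"
  assumes "(UNIV :: 'a set) \<noteq> {0}"
    and "convex_body K"
  shows "\<forall>x \<in> K. gamma_sq K x = 4 * omega K x * (1 - omega K x)"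
proof
  fix x
  assume "x \<in> K"
  define E where "E = {(a, b). \<exists>l \<in> chord_lines K x. chord_ends K x l a b}"
  define ratio where "ratio = (\<lambda>(a, b). norm (a - x) / norm (a - b))"
  have E: "x \<in> closed_segment a b" "a \<noteq> b" "norm (x - b) \<le> norm (x - a)"
    if "(a, b) \<in> E" for a b
    using that \<open>x \<in> K\<close> base_between_chord_ends unfolding E_def chord_ends_def by blast+
  have bounds: "1/2 \<le> w \<and> w \<le> 1" if w: "w \<in> ratio ` E" for w
  proof -
    from w obtain a b where ab: "(a, b) \<in> E" and "w = norm (a - x) / norm (a - b)"
      unfolding ratio_def by (elim imageE) (auto intro: that)
    then show ?thesis
      using far_ratio_bounds[OF E[OF ab]] by metis
  qed
  have omega: "omega K x = Sup (ratio ` E)"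
    unfolding omega_def by (rule arg_cong[where f = Sup]) (force simp: E_def ratio_def)
  have "gamma_sq K x =
      (INF (a, b)\<in>E. norm (b - x) * norm (a - x) / (norm ((1/2) *\<^sub>R (b - a)))\<^sup>2)"
    unfolding gamma_sq_def by (rule arg_cong[where f = Inf]) (force simp: E_def)
  also have "\<dots> = (INF e\<in>E. 4 * ratio e * (1 - ratio e))"
  proof (rule INF_cong[OF refl])
    fix e
    assume "e \<in> E"
    moreover obtain a b where "e = (a, b)"
      by fastforce
    ultimately show "(case e of (a, b) \<Rightarrow>
        norm (b - x) * norm (a - x) / (norm ((1/2) *\<^sub>R (b - a)))\<^sup>2) =
        4 * ratio e * (1 - ratio e)"
      using E product_ratio_eq_parabola[of x a b] by (simp add: ratio_def)
  qed
  also have "\<dots> = (INF w\<in>ratio ` E. 4 * w * (1 - w))"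
    by (simp add: image_image)
  also have "\<dots> = 4 * Sup (ratio ` E) * (1 - Sup (ratio ` E))"
  proof (rule Inf_parabola_image)
    obtain p where "p \<in> K" "p \<noteq> x"
      using interior_nonempty_imp_other_point assms unfolding convex_body_def by blast
    then obtain l where l: "l \<in> chord_lines K x"
      using chord_lines_nonempty \<open>x \<in> K\<close> by blast
    then obtain a b where "chord_ends K x l a b"
      using chord_ends_exist assms(2) unfolding convex_body_def by blast
    then show "ratio ` E \<noteq> {}"
      using l unfolding E_def by blast
    show "bdd_above (ratio ` E)"
      by (rule bdd_aboveI[of _ 1]) (use bounds in blast)
    show "1/2 \<le> w" if "w \<in> ratio ` E" for w
      using that bounds by blast
  qed
  finally show "gamma_sq K x = 4 * omega K x * (1 - omega K x)"
    by (simp only: omega)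
qed

end
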